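(* Let $m,n \geq k \geq 1$ be integers. Given $A=(a_{ij}) \in \mathbb{R}^{m \times n}$, the following statements are equivalent. (i) The matrix $A$ is totally positive of order $k$. (ii) For every square submatrix $A_r$ of $A$ of size $r\in \{1,\ldots,k\}$, $\mathrm{LCP}(A_r,q)$ has a unique solution for all $q \in \mathbb{R}^r$. (iii) For every contiguous square submatrix $A_r$ of $A$ of size $r\in \{1,\ldots,k\}$, $\mathrm{LCP}(A_r,q)$ has a unique solution for all $q \in \mathbb{R}^r$ with $q<0$. (iv) For every contiguous square submatrix $A_r$ of $A$ of size $2\leq r \leq k$ and for all $q \in \mathbb{R}^r$ with $q<0$, the solution set $\mathrm{SOL}(A_r,q)$ does not simultaneously contain a vector with sign pattern $(+,0,+,0,\ldots)^T$ and a vector with sign pattern $(0,+,0,+,\ldots)^T$. Moreover, for $r=1$: for all $i\in \{1,\ldots,m\}$ and $j \in\{1,\ldots,n\}$, $\mathrm{LCP}((a_{ij})_{1\times 1},q)$ has a solution for some scalar $q<0$.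
   Context: A real matrix is totally positive of order $k$ ($TP_k$) if all its minors of order at most $k$ are positive. A contiguous submatrix is one whose row index set and column index set are each sets of consecutive integers. For a vector $x$, $x\ge 0$ (resp. $x<0$) means every coordinate is $\ge 0$ (resp. $<0$). For $M\in\mathbb{R}^{r\times r}$ and $q\in\mathbb{R}^r$, the Linear Complementarity Problem $\mathrm{LCP}(M,q)$ asks for $x\in\mathbb{R}^r$ with $x\ge 0$, $y=Mx+q\ge 0$ and $x^Ty=0$; any such $x$ is a solution, and $\mathrm{SOL}(M,q)$ denotes the set of all solutions. Sign pattern $(+,0,+,0,\ldots)^T$ means the odd-indexed coordinates are positive and the even-indexed ones are zero; $(0,+,0,+,\ldots)^T$ means the even-indexed coordinates are positive and the odd-indexed ones are zero. *)

theory Defs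
  imports Complex_Main "Jordan_Normal_Form.Determinant" "Jordan_Normal_Form.DL_Submatrix"
begin

definition square_submatrices :: "nat \<Rightarrow> 'a mat \<Rightarrow> 'a mat set" where
  "square_submatrices r A = {submatrix A I J | I J.
     I \<subseteq> {0..<dim_row A} \<and> J \<subseteq> {0..<dim_col A} \<and> card I = r \<and> card J = r}"

definition consecutive :: "nat set \<Rightarrow> bool" where
  "consecutive I \<longleftrightarrow> (\<exists>a b. I = {a..<b})"

definition contiguous_square_submatrices :: "nat \<Rightarrow> 'a mat \<Rightarrow> 'a mat set" where
  "contiguous_square_submatrices r A = {submatrix A I J | I J.
     I \<subseteq> {0..<dim_row A} \<and> J \<subseteq> {0..<dim_col A} \<and> card I = r \<and> card J = r \<and>
     consecutive I \<and> consecutive J}"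

definition totally_positive_of_order :: "nat \<Rightarrow> real mat \<Rightarrow> bool" where
  "totally_positive_of_order k A \<longleftrightarrow> (\<forall>r\<in>{1..k}. \<forall>B\<in>square_submatrices r A. det B > 0)"

text \<open>
  The library order on vectors is coordinatewise (and demands equal dimensions) for \<open>\<le>\<close>, but its
  \<open><\<close> only means \<open>\<le>\<close> and not \<open>\<ge>\<close>. Coordinatewise strict negativity therefore gets its own predicate.
\<close>

definition vec_negative :: "real vec \<Rightarrow> bool" where
  "vec_negative q \<longleftrightarrow> (\<forall>i<dim_vec q. q $ i < 0)"

definition LCP_SOL :: "real mat \<Rightarrow> real vec \<Rightarrow> real vec set" where
  "LCP_SOL M q = {x \<in> carrier_vec (dim_vec q). 0\<^sub>v (dim_vec q) \<le> x \<and>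
     0\<^sub>v (dim_vec q) \<le> M *\<^sub>v x + q \<and> x \<bullet> (M *\<^sub>v x + q) = 0}"

text \<open>
  The sign patterns \<open>(+,0,+,0,\<dots>)\<close> and \<open>(0,+,0,+,\<dots>)\<close>. Vector indices start at 0 here,
  so the first, third, \<open>\<dots>\<close> coordinates are those with even index.
\<close>

definition sign_pattern_plus_zero :: "real vec \<Rightarrow> bool" where
  "sign_pattern_plus_zero x \<longleftrightarrow> (\<forall>i<dim_vec x. if even i then x $ i > 0 else x $ i = 0)"

definition sign_pattern_zero_plus :: "real vec \<Rightarrow> bool" where
  "sign_pattern_zero_plus x \<longleftrightarrow> (\<forall>i<dim_vec x. if even i then x $ i = 0 else x $ i > 0)"

end

theory Submission
  imports Defs
begin

text \<open>
  Principal minors of a \<open>TP\<^sub>k\<close> submatrix are minors of \<open>A\<close>, so each such submatrix is a P-matrix and reverses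
  the sign of no nonzero vector (Fiedler and Ptak), which gives uniqueness for the LCP, and existence by
  induction on the size. Conversely, suppose all minors of order \<open>r - 1\<close> are positive but some contiguous
  minor of order \<open>r\<close> is not. The cofactors along the first row of that submatrix \<open>M\<close> form a strictly
  alternating vector \<open>x\<close> with \<open>M x = det M \<cdot> e\<^sub>0 \<le> 0\<close>, and its positive and negative parts both solve
  \<open>LCP(M, q)\<close> for \<open>q = - M x\<^sup>+ < 0\<close>, contradicting (iv). Hence contiguous minors of order \<open>r\<close> are positive,
  and Fekete's criterion extends this to all minors of order \<open>r\<close>.
\<close>

section \<open>Determinants of entry functions\<close>

text \<open>Using entry functions instead of matrices turns the choice of rows and columns into
  composition with index maps. Values of \<open>B\<close> outside \<open>r\<close> do not
  matter.\<close>

definition fdet :: "nat \<Rightarrow> (nat \<Rightarrow> nat \<Rightarrow> 'a :: comm_ring_1) \<Rightarrow> 'a" where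
  "fdet r B = det (mat r r (\<lambda>(i, j). B i j))"

lemma fdet_cong:
  assumes "\<And>i j. i < r \<Longrightarrow> j < r \<Longrightarrow> B i j = C i j"
  shows "fdet r B = fdet r C"
  unfolding fdet_def using assms by (intro arg_cong[where f = det] eq_matI) auto

lemma fdet_transpose: "fdet r (\<lambda>i j. B j i) = fdet r B"
proof -
  have "mat r r (\<lambda>(i, j). B j i) = transpose_mat (mat r r (\<lambda>(i, j). B i j))"
    by (intro eq_matI) auto
  then show ?thesis
    unfolding fdet_def by (simp add: det_transpose[of _ r])
qed

lemma fdet_expand_row:
  assumes p: "p < Suc r"
  shows "fdet (Suc r) B =
    (\<Sum>j<Suc r. (-1) ^ (p + j) * B p j * fdet r (\<lambda>a b. B (insert_index p a) (insert_index j b)))"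
proof -
  let ?M = "mat (Suc r) (Suc r) (\<lambda>(i, j). B i j)"
  have del: "mat_delete ?M p j = mat r r (\<lambda>(a, b). B (insert_index p a) (insert_index j b))"
    if "j < Suc r" for j
    using p that unfolding mat_delete_def by (intro eq_matI) (auto simp: insert_index_def)
  have "det ?M = (\<Sum>j<Suc r. ?M $$ (p, j) * cofactor ?M p j)"
    by (rule laplace_expansion_row[OF _ p]) simp
  also have "\<dots> = (\<Sum>j<Suc r. (-1) ^ (p + j) * B p j
      * fdet r (\<lambda>a b. B (insert_index p a) (insert_index j b)))"
    using p by (intro sum.cong refl) (simp add: cofactor_def del fdet_def)
  finally show ?thesis unfolding fdet_def .
qed

lemma fdet_expand_column:
  assumes p: "p < Suc r"
  shows "fdet (Suc r) B =
    (\<Sum>i<Suc r. (-1) ^ (i + p) * B i p * fdet r (\<lambda>a b. B (insert_index i a) (insert_index p b)))"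
  using fdet_expand_row[OF p, of "\<lambda>i j. B j i"]
  by (simp add: fdet_transpose[of _ B] add.commute
      fdet_transpose[of r "\<lambda>a b. B (insert_index i a) (insert_index p b)" for i])

lemma fdet_identical_rows:
  assumes "i < r" "j < r" "i \<noteq> j" "\<And>l. l < r \<Longrightarrow> B i l = B j l"
  shows "fdet r B = 0"
  unfolding fdet_def
  using assms by (intro det_identical_rows[OF _ assms(3,1,2)]) (auto intro!: eq_vecI)

lemma fdet_identical_columns:
  assumes "i < r" "j < r" "i \<noteq> j" "\<And>l. l < r \<Longrightarrow> B l i = B l j"
  shows "fdet r B = 0"
  using fdet_identical_rows[OF assms(1-3), of "\<lambda>i j. B j i"] assms(4)
  by (simp add: fdet_transpose[of r B])

text \<open>The cofactors along row \<open>p\<close> do not see row \<open>p\<close>, so the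
  expansion is linear in that row. The added \<open>b\<close> sits on the diagonal, where the
  cofactor sign is positive.\<close>

lemma fdet_affine_row:
  assumes p: "p < Suc r"
    and other: "\<And>i j. i \<noteq> p \<Longrightarrow> C i j = B i j"
    and row: "\<And>j. C p j = a * B p j + (if j = p then b else 0)"
  shows "fdet (Suc r) C
    = a * fdet (Suc r) B + b * fdet r (\<lambda>i j. B (insert_index p i) (insert_index p j))"
proof -
  let ?m = "\<lambda>j. fdet r (\<lambda>a b. B (insert_index p a) (insert_index j b))"
  have "fdet (Suc r) C = (\<Sum>j<Suc r. (-1) ^ (p + j) * C p j * ?m j)"
    unfolding fdet_expand_row[OF p, of C]
    by (intro sum.cong refl arg_cong2[where f = "(*)"] fdet_cong other) (auto simp: insert_index_def)
  also have "\<dots> = (\<Sum>j<Suc r. a * ((-1) ^ (p + j) * B p j * ?m j) + (if j = p then b * ?m p else 0))"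
    by (intro sum.cong refl) (auto simp: row algebra_simps simp flip: power_add)
  also have "\<dots> = a * fdet (Suc r) B + b * ?m p"
    unfolding fdet_expand_row[OF p, of B] using p
    by (simp add: sum.distrib sum_distrib_left sum.delta del: sum.lessThan_Suc)
  finally show ?thesis .
qed

section \<open>Strictly increasing index maps\<close>

text \<open>Stands for an \<open>r\<close>-element subset of the indices below \<open>m\<close>,
  listed in order. Submatrices of submatrices then arise by composition.\<close>

definition increasing_below :: "nat \<Rightarrow> nat \<Rightarrow> (nat \<Rightarrow> nat) \<Rightarrow> bool" where
  "increasing_below r m f \<longleftrightarrow> (\<forall>i<r. f i < m) \<and> (\<forall>j<r. \<forall>i<j. f i < f j)"

lemma increasing_below_comp:
  "increasing_below r m f \<Longrightarrow> increasing_below s r e \<Longrightarrow> increasing_below s m (f \<circ> e)"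
  unfolding increasing_below_def by auto

lemma increasing_below_insert_index: "increasing_below r (Suc r) (insert_index p)"
  unfolding increasing_below_def insert_index_def by auto

lemma increasing_below_shift: "a + r \<le> m \<Longrightarrow> increasing_below r m (\<lambda>i. a + i)"
  unfolding increasing_below_def by auto

lemma increasing_below_mono: "increasing_below r m f \<Longrightarrow> s \<le> r \<Longrightarrow> increasing_below s m f"
  unfolding increasing_below_def by auto

section \<open>The linear complementarity problem for P-matrices\<close>

text \<open>Complementarity is required in each coordinate; for nonnegative vectors this agrees with
  a vanishing inner product.\<close>

definition lcp_sol :: "nat \<Rightarrow> (nat \<Rightarrow> nat \<Rightarrow> real) \<Rightarrow> (nat \<Rightarrow> real) \<Rightarrow> (nat \<Rightarrow> real) \<Rightarrow> bool" where
  "lcp_sol r B q x \<longleftrightarrow> (\<forall>i<r. 0 \<le> x i \<and> 0 \<le> (\<Sum>j<r. B i j * x j) + q i \<and>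
     x i * ((\<Sum>j<r. B i j * x j) + q i) = 0)"

text \<open>The Fiedler-Ptak property of P-matrices. Existence and uniqueness for the LCP are
  derived from it alone, without determinants.\<close>

definition reverses_no_signs :: "nat \<Rightarrow> (nat \<Rightarrow> nat \<Rightarrow> real) \<Rightarrow> bool" where
  "reverses_no_signs r B \<longleftrightarrow>
     (\<forall>x. (\<exists>i<r. x i \<noteq> 0) \<longrightarrow> (\<exists>i<r. x i * (\<Sum>j<r. B i j * x j) > 0))"

lemma complementary_difference:
  fixes a b c d :: real
  assumes "0 \<le> a" "0 \<le> b" "a * b = 0" "0 \<le> c" "0 \<le> d" "c * d = 0"
  shows "(a - c) * (b - d) \<le> 0"
proof -
  have "(a - c) * (b - d) = a * b + c * d - a * d - c * b" by (simp add: algebra_simps)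
  then show ?thesis using assms mult_nonneg_nonneg[of a d] mult_nonneg_nonneg[of c b] by linarith
qed

text \<open>\<open>B\<close> would reverse every sign of the difference of two distinct solutions,
  because the slacks differ by \<open>B\<close> applied to that difference.\<close>

lemma lcp_sol_unique:
  assumes B: "reverses_no_signs r B" and x: "lcp_sol r B q x" and y: "lcp_sol r B q y" and i: "i < r"
  shows "x i = y i"
proof (rule ccontr)
  assume "x i \<noteq> y i"
  then obtain k where k: "k < r" "(x k - y k) * (\<Sum>j<r. B k j * (x j - y j)) > 0"
    using B[unfolded reverses_no_signs_def, rule_format, of "\<lambda>i. x i - y i"] i by auto
  have "(\<Sum>j<r. B k j * (x j - y j))
      = ((\<Sum>j<r. B k j * x j) + q k) - ((\<Sum>j<r. B k j * y j) + q k)"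
    by (simp add: sum_subtractf algebra_simps)
  moreover have "(x k - y k) * (((\<Sum>j<r. B k j * x j) + q k) - ((\<Sum>j<r. B k j * y j) + q k)) \<le> 0"
    using x y k(1) unfolding lcp_sol_def by (intro complementary_difference) auto
  ultimately show False using k(2) by simp
qed

lemma reverses_no_signs_diag_pos:
  assumes B: "reverses_no_signs r B" and i: "i < r"
  shows "B i i > 0"
proof -
  obtain k where k: "k < r" "(if k = i then 1 else 0) * (\<Sum>j<r. B k j * (if j = i then 1 else 0)) > 0"
    using B[unfolded reverses_no_signs_def, rule_format, of "\<lambda>k. if k = i then 1 else 0"] i by force
  then have "k = i" by (auto split: if_splits)
  then have "(\<Sum>j<r. B i j * (if j = i then 1 else 0)) > 0" using k by simp
  also have "(\<Sum>j<r. B i j * (if j = i then 1 else 0)) = B i i"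
    using i by (simp add: if_distrib[of "\<lambda>z. _ * z"] sum.delta cong: if_cong)
  finally show ?thesis .
qed

lemma reverses_no_signs_leading:
  assumes B: "reverses_no_signs (Suc r) B"
  shows "reverses_no_signs r B"
  unfolding reverses_no_signs_def
proof (intro allI impI)
  fix x :: "nat \<Rightarrow> real" assume x: "\<exists>i<r. x i \<noteq> 0"
  define z where "z = x(r := 0)"
  have sum: "(\<Sum>j<Suc r. B i j * z j) = (\<Sum>j<r. B i j * x j)" for i
    by (simp add: z_def)
  have "\<exists>i<Suc r. z i \<noteq> 0" using x by (force simp: z_def)
  then obtain i where i: "i < Suc r" "z i * (\<Sum>j<r. B i j * x j) > 0"
    using B unfolding reverses_no_signs_def sum[symmetric] by blast
  then show "\<exists>i<r. x i * (\<Sum>j<r. B i j * x j) > 0"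
    by (intro exI[of _ i]) (auto simp: z_def less_Suc_eq split: if_splits)
qed

section \<open>Schur complements and existence of solutions\<close>

text \<open>The Schur complement of the pivot \<open>B r r\<close>. It is also evaluated at
  \<open>i = r\<close>, where the row vanishes.\<close>

definition schur :: "nat \<Rightarrow> (nat \<Rightarrow> nat \<Rightarrow> real) \<Rightarrow> nat \<Rightarrow> nat \<Rightarrow> real" where
  "schur r B i j = B i j - B i r * B r j / B r r"

text \<open>The value of \<open>z r\<close> solves the last equation, making coordinate
  \<open>r\<close> of \<open>B z\<close> equal to \<open>- c\<close>. Substituting it eliminates the
  last unknown from the other rows.\<close>

lemma schur_elimination:
  assumes "B r r \<noteq> 0" "z r = - (c + (\<Sum>j<r. B r j * z j)) / B r r"
  shows "(\<Sum>j<Suc r. B i j * z j) = (\<Sum>j<r. schur r B i j * z j) - B i r * c / B r r"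
proof -
  have "(\<Sum>j<r. schur r B i j * z j) = (\<Sum>j<r. B i j * z j) - B i r / B r r * (\<Sum>j<r. B r j * z j)"
    by (simp add: schur_def algebra_simps sum_subtractf sum_distrib_left)
  moreover have "B i r * z r = - (B i r * c / B r r) - B i r / B r r * (\<Sum>j<r. B r j * z j)"
    unfolding assms(2) using assms(1) by (simp add: field_simps)
  ultimately show ?thesis by simp
qed

text \<open>Extend \<open>x\<close> by the last coordinate that makes row \<open>r\<close> of the
  product zero. The index with a preserved sign then cannot be \<open>r\<close>.\<close>

lemma reverses_no_signs_schur:
  assumes B: "reverses_no_signs (Suc r) B"
  shows "reverses_no_signs r (schur r B)"
  unfolding reverses_no_signs_def
proof (intro allI impI)
  fix x :: "nat \<Rightarrow> real" assume x: "\<exists>i<r. x i \<noteq> 0"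
  have pos: "B r r > 0" using reverses_no_signs_diag_pos[OF B] by simp
  define z where "z = x(r := - (\<Sum>j<r. B r j * x j) / B r r)"
  have eq: "(\<Sum>j<r. c j * z j) = (\<Sum>j<r. c j * x j)" for c
    by (intro sum.cong) (auto simp: z_def)
  have zr: "z r = - (0 + (\<Sum>j<r. B r j * z j)) / B r r" by (simp add: eq) (simp add: z_def)
  have sum: "(\<Sum>j<Suc r. B i j * z j) = (\<Sum>j<r. schur r B i j * x j)" for i
    using schur_elimination[of B r z 0 i, OF _ zr] pos by (simp add: eq del: sum.lessThan_Suc)
  have "\<exists>i<Suc r. z i \<noteq> 0" using x by (force simp: z_def)
  then obtain i where i: "i < Suc r" "z i * (\<Sum>j<r. schur r B i j * x j) > 0"
    using B unfolding reverses_no_signs_def sum[symmetric] by blast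
  have "(\<Sum>j<r. schur r B r j * x j) = 0" using pos by (simp add: schur_def)
  with i have "i \<noteq> r" by auto
  with i show "\<exists>i<r. x i * (\<Sum>j<r. schur r B i j * x j) > 0"
    by (intro exI[of _ i]) (auto simp: z_def)
qed

text \<open>In a solution the last unknown or the last slack is zero. The first case reduces to the
  leading block, the second to the Schur complement.\<close>

lemma lcp_sol_exists:
  assumes "reverses_no_signs r B"
  shows "\<exists>x. lcp_sol r B q x"
  using assms
proof (induction r arbitrary: B q)
  case 0
  then show ?case by (simp add: lcp_sol_def)
next
  case (Suc r)
  have pos: "B r r > 0" using reverses_no_signs_diag_pos[OF Suc.prems] by simp
  obtain u0 where u0: "lcp_sol r B q u0"
    using Suc.IH[OF reverses_no_signs_leading[OF Suc.prems]] by blast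
  define u where "u = u0(r := 0)"
  have usum: "(\<Sum>j<Suc r. B i j * u j) = (\<Sum>j<r. B i j * u0 j)" for i
    by (simp add: u_def)
  have u: "0 \<le> u i \<and> 0 \<le> (\<Sum>j<Suc r. B i j * u j) + q i \<and>
      u i * ((\<Sum>j<Suc r. B i j * u j) + q i) = 0" if "i < r" for i
    unfolding usum using u0 that by (simp add: lcp_sol_def u_def)
  have ur: "u r = 0" by (simp add: u_def)
  let ?yu = "\<lambda>i. (\<Sum>j<Suc r. B i j * u j) + q i"
  show ?case
  proof (cases "?yu r \<ge> 0")
    case True
    then have "lcp_sol (Suc r) B q u"
      unfolding lcp_sol_def using u ur by (auto simp del: sum.lessThan_Suc simp: less_Suc_eq)
    then show ?thesis by blast
  next
    case False
    \<comment> \<open>The trial value 0 for the last unknown fails, so force the last slack to 0 instead; the difference of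
      the two trial vectors then has its non-reversed sign at the last index, which makes \<open>v r\<close> positive.\<close>
    define q' where "q' i = q i - B i r * q r / B r r" for i
    obtain v0 where v0: "lcp_sol r (schur r B) q' v0"
      using Suc.IH[OF reverses_no_signs_schur[OF Suc.prems]] by blast
    define v where "v = v0(r := - (q r + (\<Sum>j<r. B r j * v0 j)) / B r r)"
    let ?yv = "\<lambda>i. (\<Sum>j<Suc r. B i j * v j) + q i"
    have eq: "(\<Sum>j<r. c j * v j) = (\<Sum>j<r. c j * v0 j)" for c
      by (intro sum.cong) (auto simp: v_def)
    have vr: "v r = - (q r + (\<Sum>j<r. B r j * v j)) / B r r" by (simp add: eq) (simp add: v_def)
    have vsum: "?yv i = (\<Sum>j<r. schur r B i j * v0 j) + q' i" for i
      using schur_elimination[of B r v "q r" i, OF _ vr] pos by (simp add: eq q'_def del: sum.lessThan_Suc)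
    have yvr: "?yv r = 0"
      unfolding vsum using pos by (simp add: schur_def q'_def)
    have v: "0 \<le> v i \<and> 0 \<le> ?yv i \<and> v i * ?yv i = 0" if "i < r" for i
      unfolding vsum using v0 that by (simp add: lcp_sol_def v_def)
    let ?z = "\<lambda>i. v i - u i"
    have zsum: "(\<Sum>j<Suc r. B i j * ?z j) = ?yv i - ?yu i" for i
      by (simp add: sum_subtractf algebra_simps)
    \<comment> \<open>Equal trial vectors would have equal last slacks, but that of \<open>v\<close>
      is zero and that of \<open>u\<close> negative.\<close>
    have "\<exists>i<Suc r. ?z i \<noteq> 0"
    proof (rule ccontr)
      assume "\<not> (\<exists>i<Suc r. ?z i \<noteq> 0)"
      then have "(\<Sum>j<Suc r. B r j * ?z j) = 0" by (intro sum.neutral) auto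
      with zsum[of r] yvr False show False by linarith
    qed
    then obtain i where i: "i < Suc r" "?z i * (?yv i - ?yu i) > 0"
      using Suc.prems[unfolded reverses_no_signs_def, rule_format, of ?z] unfolding zsum by blast
    have "?z i * (?yv i - ?yu i) \<le> 0" if "i < r"
      using u[OF that] v[OF that] by (intro complementary_difference) auto
    with i have "i = r" by force
    with i yvr ur have "v r * (0 - ?yu r) > 0" by (simp only: diff_zero)
    with False have "v r > 0" by (auto simp: zero_less_mult_iff simp del: sum.lessThan_Suc)
    with v yvr have "lcp_sol (Suc r) B q v"
      unfolding lcp_sol_def by (auto simp del: sum.lessThan_Suc simp: less_Suc_eq)
    then show ?thesis by blast
  qed
qed

section \<open>P-matrices reverse no signs\<close>

text \<open>Multilinearity in the rows writes the determinant as a nonnegative combination of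
  principal minors. The bound \<open>l\<close> counts the leading rows that may still be modified;
  each induction step splits row \<open>l - 1\<close>.\<close>

lemma fdet_diag_combination_pos:
  fixes B :: "nat \<Rightarrow> nat \<Rightarrow> real"
  assumes P: "\<And>s e. increasing_below s r e \<Longrightarrow> fdet s (\<lambda>i j. B (e i) (e j)) > 0"
  shows "increasing_below s r e \<Longrightarrow> (\<And>i. i < s \<Longrightarrow> 0 \<le> c i \<and> 0 \<le> d i \<and> 0 < c i + d i) \<Longrightarrow>
    (\<And>i. l \<le> i \<Longrightarrow> i < s \<Longrightarrow> c i = 1 \<and> d i = 0) \<Longrightarrow>
    fdet s (\<lambda>i j. c i * B (e i) (e j) + (if i = j then d i else 0)) > 0"
proof (induction l arbitrary: s e c d)
  case 0
  have "fdet s (\<lambda>i j. c i * B (e i) (e j) + (if i = j then d i else 0)) = fdet s (\<lambda>i j. B (e i) (e j))"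
    using 0 by (intro fdet_cong) auto
  then show ?case using P[OF 0(1)] by simp
next
  case (Suc l)
  show ?case
  proof (cases "l < s")
    case False
    then show ?thesis using Suc.prems by (intro Suc.IH) auto
  next
    case True
    then obtain t where s: "s = Suc t" by (cases s) auto
    \<comment> \<open>Row \<open>l\<close> is restored to its original form. The determinant is
      \<open>c l\<close> times that of \<open>C\<close> plus \<open>d l\<close> times the minor
      without row and column \<open>l\<close>, and \<open>c l\<close> and \<open>d l\<close> are not
      both zero.\<close>
    define C where "C i j = (c(l := 1)) i * B (e i) (e j) + (if i = j then (d(l := 0)) i else 0)" for i j
    have 1: "fdet s C > 0"
      unfolding C_def using Suc.prems by (intro Suc.IH) (auto simp: less_Suc_eq_le)
    have "fdet t (\<lambda>i j. (c \<circ> insert_index l) i * B ((e \<circ> insert_index l) i) ((e \<circ> insert_index l) j)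
        + (if i = j then (d \<circ> insert_index l) i else 0)) > 0"
    proof (rule Suc.IH)
      show "increasing_below t r (e \<circ> insert_index l)"
        using Suc.prems(1) increasing_below_insert_index unfolding s by (rule increasing_below_comp)
    qed (use Suc.prems(2,3) s in \<open>auto simp: insert_index_def\<close>)
    also have "fdet t (\<lambda>i j. (c \<circ> insert_index l) i * B ((e \<circ> insert_index l) i) ((e \<circ> insert_index l) j)
        + (if i = j then (d \<circ> insert_index l) i else 0))
        = fdet t (\<lambda>i j. C (insert_index l i) (insert_index l j))"
      by (intro fdet_cong) (auto simp: C_def insert_index_def)
    finally have 2: "fdet t (\<lambda>i j. C (insert_index l i) (insert_index l j)) > 0" .
    have "fdet s (\<lambda>i j. c i * B (e i) (e j) + (if i = j then d i else 0))
        = c l * fdet s C + d l * fdet t (\<lambda>i j. C (insert_index l i) (insert_index l j))"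
      unfolding s by (rule fdet_affine_row) (use True s in \<open>auto simp: C_def\<close>)
    moreover have "\<dots> > 0"
      using 1 2 Suc.prems(2)[OF True] 
      by (cases "c l = 0") (auto intro!: add_pos_nonneg)
    ultimately show ?thesis by simp
  qed
qed

text \<open>A vector with all signs reversed would be a null vector of a row-scaled and diagonally
  shifted \<open>B\<close>, whose determinant is positive by the preceding lemma.\<close>

lemma P_matrix_reverses_no_signs:
  fixes B :: "nat \<Rightarrow> nat \<Rightarrow> real"
  assumes P: "\<And>s e. increasing_below s r e \<Longrightarrow> fdet s (\<lambda>i j. B (e i) (e j)) > 0"
  shows "reverses_no_signs r B"
  unfolding reverses_no_signs_def
proof (intro allI impI, rule ccontr)
  fix x :: "nat \<Rightarrow> real"
  assume x: "\<exists>i<r. x i \<noteq> 0" and neg: "\<not> (\<exists>i<r. x i * (\<Sum>j<r. B i j * x j) > 0)"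
  define c where "c i = (if x i = 0 then 0 else 1 :: real)" for i
  define d where "d i = (if x i = 0 then 1 else - (\<Sum>j<r. B i j * x j) / x i)" for i
  \<comment> \<open>\<open>N\<close> kills \<open>x\<close>: where \<open>x i = 0\<close> its row is a unit row, elsewhere the diagonal shift cancels \<open>(B x) i\<close>.\<close>
  define N where "N i j = c i * B i j + (if i = j then d i else 0)" for i j
  have d: "0 \<le> d i" if "i < r" for i
  proof (cases "x i = 0")
    case False
    \<comment> \<open>Multiplying through by \<open>x i\<close> exposes the product whose sign is
      known from \<open>neg\<close>.\<close>
    have "d i = - (x i * (\<Sum>j<r. B i j * x j)) / (x i)\<^sup>2"
      using False by (simp add: d_def power2_eq_square)
    moreover have "0 \<le> \<dots>" using neg that by (intro divide_nonneg_nonneg) force+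
    ultimately show ?thesis by simp
  qed (simp add: d_def)
  have dc: "0 \<le> c i \<and> 0 \<le> d i \<and> 0 < c i + d i" if "i < r" for i
    using d[OF that] by (cases "x i = 0") (auto simp: c_def d_def)
  have "fdet r (\<lambda>i j. c i * B (id i) (id j) + (if i = j then d i else 0)) > 0"
    by (rule fdet_diag_combination_pos[where r = r and l = r, OF P])
      (use dc in \<open>auto simp: increasing_below_def\<close>)
  then have "det (mat r r (\<lambda>(i, j). N i j)) \<noteq> 0"
    by (simp add: fdet_def N_def)
  moreover have "det (mat r r (\<lambda>(i, j). N i j)) = 0"
  proof (rule iffD2[OF det_0_iff_vec_prod_zero[of _ r]], simp, intro exI conjI)
    show "vec r x \<in> carrier_vec r" by simp
    show "vec r x \<noteq> 0\<^sub>v r" using x by (metis index_vec index_zero_vec(1))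
    show "mat r r (\<lambda>(i, j). N i j) *\<^sub>v vec r x = 0\<^sub>v r"
    proof (rule eq_vecI)
      fix i assume "i < dim_vec (0\<^sub>v r :: real vec)"
      then have i: "i < r" by simp
      have "(mat r r (\<lambda>(i, j). N i j) *\<^sub>v vec r x) $ i = (\<Sum>j<r. N i j * x j)"
        using i by (simp add: scalar_prod_def atLeast0LessThan)
      also have "\<dots> = (\<Sum>j<r. c i * (B i j * x j) + (if j = i then d i * x i else 0))"
        by (intro sum.cong) (auto simp: N_def algebra_simps)
      also have "\<dots> = c i * (\<Sum>j<r. B i j * x j) + d i * x i"
        using i by (simp add: sum.distrib sum_distrib_left sum.delta)
      also have "\<dots> = 0" by (simp add: c_def d_def)
      finally show "(mat r r (\<lambda>(i, j). N i j) *\<^sub>v vec r x) $ i = 0\<^sub>v r $ i" using i by simp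
    qed simp
  qed
  ultimately show False by contradiction
qed

section \<open>Fekete's criterion\<close>

text \<open>A Pluecker relation for \<open>u + 3\<close> rows and \<open>u + 2\<close> columns:
  \<open>D\<close> deletes one row, while the three \<open>E\<close> terms delete two of the rows
  \<open>0\<close>, \<open>s\<close>, \<open>u + 2\<close> and the last column. All signs are plus,
  so positivity of the other five minors forces that of \<open>D s\<close>.\<close>

lemma three_term_identity:
  fixes B :: "nat \<Rightarrow> nat \<Rightarrow> 'a :: idom"
  assumes s: "0 < s" "s < Suc (Suc u)"
  defines "D i \<equiv> fdet (Suc (Suc u)) (\<lambda>a b. B (insert_index i a) b)"
    and "E R \<equiv> fdet (Suc u) (\<lambda>a b. B (R a) b)"
  shows "D s * E Suc = D 0 * E (insert_index s) + D (Suc (Suc u)) * E (insert_index s \<circ> Suc)"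
proof -
  let ?n = "Suc (Suc (Suc u))"
  \<comment> \<open>\<open>w\<close> is a left null vector of \<open>B\<close>, and the cofactor vector \<open>v\<close> makes \<open>B v\<close> vanish outside the rows
    \<open>0\<close>, \<open>s\<close> and \<open>u + 2\<close>; the identity is \<open>w B v = 0\<close>.\<close>
  define w where "w i = (-1) ^ i * D i" for i
  define other where "other = insert_index s \<circ> Suc"
  define v where "v j = (-1) ^ j * fdet u (\<lambda>a b. B (other a) (insert_index j b))" for j
  have sign: "(-1) ^ n * ((-1) ^ n * x) = x" for n and x :: 'a
    by (simp flip: mult.assoc power_mult_distrib)
  \<comment> \<open>Expand along column 0 a matrix in which column \<open>j\<close> occurs
    twice.\<close>
  have null: "(\<Sum>i<?n. w i * B i j) = 0" if j: "j < Suc (Suc u)" for j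
  proof -
    define C where "C i l = (case l of 0 \<Rightarrow> B i j | Suc l \<Rightarrow> B i l)" for i l
    have "fdet ?n C = 0"
      by (rule fdet_identical_columns[of 0 _ "Suc j"]) (use j in \<open>auto simp: C_def\<close>)
    also have "fdet ?n C = (\<Sum>i<?n. w i * B i j)"
      by (subst fdet_expand_column[OF zero_less_Suc], intro sum.cong refl)
        (simp add: w_def D_def C_def)
    finally show ?thesis .
  qed
  \<comment> \<open>\<open>other\<close> lists the rows besides \<open>0\<close>, \<open>s\<close>
    and \<open>u + 2\<close>. A minor with one further row at position \<open>p\<close> expands
    along that row with the entries of \<open>v\<close> as cofactors, up to sign.\<close>
  have bordered: "(\<Sum>j<Suc u. B (R p) j * v j) = (-1) ^ p * E R"
    if p: "p < Suc u" and R: "\<And>a. a < u \<Longrightarrow> R (insert_index p a) = other a" for p R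
  proof -
    have "(-1) ^ p * E R = (\<Sum>j<Suc u. (-1) ^ p * ((-1) ^ (p + j) * B (R p) j
        * fdet u (\<lambda>a b. B (R (insert_index p a)) (insert_index j b))))"
      unfolding E_def fdet_expand_row[OF p] sum_distrib_left ..
    also have "\<dots> = (\<Sum>j<Suc u. B (R p) j * v j)"
    proof (intro sum.cong refl)
      fix j
      have "fdet u (\<lambda>a b. B (R (insert_index p a)) (insert_index j b))
          = fdet u (\<lambda>a b. B (other a) (insert_index j b))"
        by (intro fdet_cong) (simp add: R)
      then show "(-1) ^ p * ((-1) ^ (p + j) * B (R p) j
          * fdet u (\<lambda>a b. B (R (insert_index p a)) (insert_index j b))) = B (R p) j * v j"
        by (simp only: v_def power_add mult.assoc sign) (simp only: mult.left_commute)
    qed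
    finally show ?thesis ..
  qed
  define Bv where "Bv i = (\<Sum>j<Suc u. B i j * v j)" for i
  have zero: "Bv i = 0" if i: "i < ?n" "i \<notin> {0, s, Suc (Suc u)}" for i
  proof -
    \<comment> \<open>The position of row \<open>i\<close> in \<open>other\<close>, so the bordered
      minor has a repeated row.\<close>
    define a where "a = (if i < s then i - 1 else i - 2)"
    have a: "a < u" "other a = i"
      using i s by (auto simp: a_def other_def insert_index_def)
    let ?R = "case_nat i other"
    have "Bv i = (-1) ^ 0 * E ?R"
      unfolding Bv_def using bordered[of 0 ?R] by (simp del: sum.lessThan_Suc)
    also have "E ?R = 0"
      unfolding E_def by (rule fdet_identical_rows[of 0 _ "Suc a"]) (use a in auto)
    finally show ?thesis by simp
  qed
  obtain t where t: "s = Suc t" using s by (cases s) auto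
  have Bv0: "Bv 0 = E (insert_index s)"
    unfolding Bv_def using bordered[of 0 "insert_index s"] s by (simp add: other_def del: sum.lessThan_Suc)
  \<comment> \<open>In the list \<open>1, ..., u + 1\<close> row \<open>s\<close> has position
    \<open>s - 1\<close>; this parity shift gives the minus sign that moves the term across the
    identity.\<close>
  have Bvs: "Bv s = (-1) ^ t * E Suc"
    unfolding Bv_def using bordered[of t Suc] s
    by (simp add: other_def t insert_index_def del: sum.lessThan_Suc)
  have Bvl: "Bv (Suc (Suc u)) = (-1) ^ u * E (insert_index s \<circ> Suc)"
    unfolding Bv_def using bordered[of u "insert_index s \<circ> Suc"] s
    by (simp add: other_def insert_index_def del: sum.lessThan_Suc)
  have "0 = (\<Sum>j<Suc u. (\<Sum>i<?n. w i * B i j) * v j)"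
    by (rule sum.neutral[symmetric]) (simp add: null del: sum.lessThan_Suc)
  also have "\<dots> = (\<Sum>i<?n. w i * Bv i)"
    unfolding Bv_def sum_distrib_left sum_distrib_right
    by (subst sum.swap) (simp add: mult_ac del: sum.lessThan_Suc)
  also have "\<dots> = (\<Sum>i\<in>{0, s, Suc (Suc u)}. w i * Bv i)"
    using s zero by (intro sum.mono_neutral_right) auto
  also have "\<dots> = w 0 * Bv 0 + w s * Bv s + w (Suc (Suc u)) * Bv (Suc (Suc u))"
    using s by (simp add: add_ac)
  also have "\<dots> = D 0 * E (insert_index s) - D s * E Suc
      + D (Suc (Suc u)) * E (insert_index s \<circ> Suc)"
  proof -
    have "(-1) ^ s * D s * ((-1) ^ t * E Suc) = - (D s * E Suc)"
      by (simp only: t power_Suc mult.assoc mult.left_commute[of "D _"] sign) simp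
    moreover have "(-1) ^ Suc (Suc u) * D (Suc (Suc u)) * ((-1) ^ u * E (insert_index s \<circ> Suc))
        = D (Suc (Suc u)) * E (insert_index s \<circ> Suc)"
      by (simp only: power_Suc mult.assoc mult.left_commute[of "D _"] sign) simp
    ultimately show ?thesis by (simp add: Bv0 Bvs Bvl w_def)
  qed
  finally show ?thesis by (simp add: algebra_simps)
qed

text \<open>Fekete's criterion in the rows only, with the columns fixed; \<open>lower\<close>
  concerns the first \<open>r - 1\<close> of them. The induction is on the spread of the chosen
  rows.\<close>

lemma fekete_rows:
  fixes B :: "nat \<Rightarrow> nat \<Rightarrow> real"
  assumes contiguous: "\<And>a. a + r \<le> m \<Longrightarrow> fdet r (\<lambda>i j. B (a + i) j) > 0"
    and lower: "\<And>f. increasing_below (r - 1) m f \<Longrightarrow> fdet (r - 1) (\<lambda>i j. B (f i) j) > 0"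
    and f: "increasing_below r m f"
  shows "fdet r (\<lambda>i j. B (f i) j) > 0"
  using f
proof (induction "f (r - 1) - f 0" arbitrary: f rule: less_induct)
  case less
  show ?case
  proof (cases "\<exists>t. Suc t < r \<and> f (Suc t) \<noteq> Suc (f t)")
    \<comment> \<open>Without a gap \<open>f\<close> is a translation and the minor is
      contiguous.\<close>
    case False
    have shift: "f i = f 0 + i" if "i < r" for i
      using that by (induction i) (use False in auto)
    have "f 0 + r \<le> m" if "r > 0"
    proof -
      have "f (r - 1) < m" using less.prems \<open>r > 0\<close> by (simp add: increasing_below_def)
      with shift[of "r - 1"] \<open>r > 0\<close> show ?thesis by simp
    qed
    then have "fdet r (\<lambda>i j. B (f 0 + i) j) > 0"
      by (cases "r = 0") (simp add: fdet_def, simp add: contiguous)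
    also have "fdet r (\<lambda>i j. B (f 0 + i) j) = fdet r (\<lambda>i j. B (f i) j)"
      by (intro fdet_cong) (simp flip: shift)
    finally show ?thesis .
  next
    case True
    then obtain t where t: "Suc t < r" "f (Suc t) \<noteq> Suc (f t)" by blast
    then obtain u where r: "r = Suc (Suc u)"
      using that[of "r - 2"] by simp
    have inc: "f i < f j" if "i < j" "j < r" for i j
      using less.prems that by (auto simp: increasing_below_def)
    have "f t < f (Suc t)" using inc t by simp
    with t have gap: "Suc (f t) < f (Suc t)" by simp
    have le: "f i \<le> f j" if "i \<le> j" "j < r" for i j
      using inc[of i j] that by (cases "i = j") auto
    \<comment> \<open>Filling the gap lets the three-term identity express the minor by minors of smaller dispersion.\<close>
    define h where "h i = (if i \<le> t then f i else if i = Suc t then Suc (f t) else f (i - 1))" for i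
    have h: "increasing_below (Suc r) m h"
      unfolding increasing_below_def
    proof (intro conjI allI impI)
      fix i assume "i < Suc r"
      then show "h i < m"
        using less.prems t gap by (auto simp: h_def increasing_below_def intro: less_trans)
    next
      fix i j assume ij: "j < Suc r" "i < j"
      have "f (Suc t) \<le> f (j - 1)" if "Suc t < j" using le[of "Suc t" "j - 1"] that ij by simp
      with ij show "h i < h j"
        using inc[of i j] inc[of i "j - 1"] inc[of "i - 1" "j - 1"] le[of i t] gap t
        by (auto simp: h_def)
    qed
    have hf: "h (insert_index (Suc t) i) = f i" for i
      by (auto simp: h_def insert_index_def)
    have ends: "h 0 = f 0" "h r = f (r - 1)" using t by (auto simp: h_def)
    have hinc: "h i < h j" if "i < j" "j < Suc r" for i j
      using h that by (auto simp: increasing_below_def)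
    let ?C = "\<lambda>i j. B (h i) j"
    let ?D = "\<lambda>i. fdet r (\<lambda>a b. ?C (insert_index i a) b)"
    let ?E = "\<lambda>R. fdet (Suc u) (\<lambda>a b. ?C (R a) b)"
    \<comment> \<open>Deleting either end row of the filled-in list narrows the spread, so the
      induction hypothesis applies.\<close>
    have D: "?D i > 0" if "i = 0 \<or> i = r" for i
    proof -
      have inc_i: "increasing_below r m (h \<circ> insert_index i)"
        using h increasing_below_insert_index by (rule increasing_below_comp)
      have "(h \<circ> insert_index i) (r - 1) - (h \<circ> insert_index i) 0 < f (r - 1) - f 0"
      proof (cases "i = 0")
        case True
        have "h 0 < h 1" "h 1 \<le> h r" using hinc[of 0 1] hinc[of 1 r] r by auto
        then show ?thesis using True r ends by (simp add: insert_index_def)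
      next
        case False
        then have "i = r" using that by simp
        moreover have "h (r - 1) < h r" "h 0 \<le> h (r - 1)" using hinc[of 0 "r - 1"] hinc[of "r - 1" r] r by auto
        ultimately show ?thesis using r ends by (simp add: insert_index_def)
      qed
      from less.hyps[OF this inc_i] show ?thesis by simp
    qed
    have E: "?E R > 0" if "increasing_below (Suc u) (Suc r) R" for R
      using lower[of "h \<circ> R"] increasing_below_comp[OF h that] by (simp add: r)
    have "increasing_below (Suc u) (Suc r) Suc"
      "increasing_below (Suc u) (Suc r) (insert_index (Suc t))"
      "increasing_below (Suc u) (Suc r) (insert_index (Suc t) \<circ> Suc)"
      by (auto simp: r increasing_below_def insert_index_def)
    note E = this[THEN E]
    have "?D (Suc t) * ?E Suc = ?D 0 * ?E (insert_index (Suc t)) + ?D r * ?E (insert_index (Suc t) \<circ> Suc)"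
      using three_term_identity[of "Suc t" u ?C] t(1) by (simp add: r)
    also have "\<dots> > 0"
      using E D[of 0] D[of r] by (intro add_pos_pos mult_pos_pos) simp_all
    finally have "?D (Suc t) > 0" using E(1) by (simp add: zero_less_mult_iff)
    then show ?thesis by (simp add: hf)
  qed
qed

text \<open>Two passes of the one-sided criterion: first free the rows over contiguous columns, then
  free the columns of the transposed minors.\<close>

lemma fekete:
  fixes A :: "nat \<Rightarrow> nat \<Rightarrow> real"
  assumes contiguous: "\<And>a b. a + r \<le> m \<Longrightarrow> b + r \<le> n \<Longrightarrow> fdet r (\<lambda>i j. A (a + i) (b + j)) > 0"
    and lower: "\<And>f g. increasing_below (r - 1) m f \<Longrightarrow> increasing_below (r - 1) n g \<Longrightarrow>
      fdet (r - 1) (\<lambda>i j. A (f i) (g j)) > 0"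
    and f: "increasing_below r m f" and g: "increasing_below r n g"
  shows "fdet r (\<lambda>i j. A (f i) (g j)) > 0"
proof -
  have rows: "fdet r (\<lambda>i j. A (f i) (b + j)) > 0" if "b + r \<le> n" for b
  proof (rule fekete_rows[where B = "\<lambda>i j. A i (b + j)", OF _ _ f])
    fix a assume "a + r \<le> m"
    then show "fdet r (\<lambda>i j. A (a + i) (b + j)) > 0" using that by (rule contiguous)
  next
    fix f' assume f': "increasing_below (r - 1) m f'"
    show "fdet (r - 1) (\<lambda>i j. A (f' i) (b + j)) > 0"
      using f' by (rule lower) (use that in \<open>auto intro: increasing_below_shift\<close>)
  qed
  have "fdet r (\<lambda>j i. A (f i) (g j)) > 0"
  proof (rule fekete_rows[where B = "\<lambda>j i. A (f i) j", OF _ _ g])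
    fix b assume "b + r \<le> n"
    then show "fdet r (\<lambda>j i. A (f i) (b + j)) > 0"
      using rows fdet_transpose[of r "\<lambda>i j. A (f i) (b + j)"] by simp
  next
    fix g' assume g': "increasing_below (r - 1) n g'"
    have "increasing_below (r - 1) m f" using f by (rule increasing_below_mono) simp
    then show "fdet (r - 1) (\<lambda>j i. A (f i) (g' j)) > 0"
      using lower[OF _ g'] fdet_transpose[of "r - 1" "\<lambda>i j. A (f i) (g' j)"] by simp
  qed
  then show ?thesis using fdet_transpose[of r "\<lambda>i j. A (f i) (g j)"] by simp
qed

section \<open>Submatrices and solution sets\<close>

text \<open>Exactly \<open>i\<close> elements of the image lie below \<open>f i\<close>, and
  \<open>pick\<close> enumerates in increasing order.\<close>

lemma pick_image_increasing:
  assumes f: "increasing_below r m f" and i: "i < r"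
  shows "pick (f ` {..<r}) i = f i"
proof -
  have less: "f a < f b \<longleftrightarrow> a < b" if "a < r" "b < r" for a b
    using f that unfolding increasing_below_def by (metis less_asym linorder_neqE_nat)
  then have "{a \<in> f ` {..<r}. a < f i} = f ` {..<i}" using i by auto
  moreover have "inj_on f {..<i}"
    using i less by (intro inj_onI) (metis lessThan_iff less_irrefl less_trans linorder_neqE_nat)
  ultimately have "card {a \<in> f ` {..<r}. a < f i} = i" by (simp add: card_image)
  then show ?thesis using pick_card_in_set[of "f i" "f ` {..<r}"] i by simp
qed

lemma card_image_increasing:
  assumes f: "increasing_below r m f"
  shows "card (f ` {..<r}) = r"
proof -
  have "inj_on f {..<r}"
    using f unfolding increasing_below_def
    by (intro inj_onI) (metis lessThan_iff less_irrefl linorder_neqE_nat)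
  then show ?thesis by (simp add: card_image)
qed

lemma increasing_below_pick:
  assumes "I \<subseteq> {0..<m}" "card I = r"
  shows "increasing_below r m (pick I)"
  unfolding increasing_below_def
proof (intro conjI allI impI)
  fix i assume "i < r"
  then have "pick I i \<in> I" using assms(2) by (intro pick_in_set) simp
  then show "pick I i < m" using assms(1) by auto
next
  fix i j assume "j < r" "i < j"
  then show "pick I i < pick I j" using assms(2) by (intro pick_mono) simp_all
qed

lemma submatrix_eq_mat:
  assumes "I \<subseteq> {0..<dim_row A}" "J \<subseteq> {0..<dim_col A}" "card I = r" "card J = r"
  shows "submatrix A I J = mat r r (\<lambda>(i, j). A $$ (pick I i, pick J j))"
proof -
  have "{i. i < dim_row A \<and> i \<in> I} = I" "{j. j < dim_col A \<and> j \<in> J} = J" using assms by auto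
  then show ?thesis using assms unfolding submatrix_def by simp
qed

lemma submatrix_image_increasing:
  assumes f: "increasing_below r (dim_row A) f" and g: "increasing_below r (dim_col A) g"
  shows "submatrix A (f ` {..<r}) (g ` {..<r}) = mat r r (\<lambda>(i, j). A $$ (f i, g j))"
proof -
  have "submatrix A (f ` {..<r}) (g ` {..<r})
      = mat r r (\<lambda>(i, j). A $$ (pick (f ` {..<r}) i, pick (g ` {..<r}) j))"
    using f g by (intro submatrix_eq_mat card_image_increasing[OF f] card_image_increasing[OF g])
      (auto simp: increasing_below_def)
  also have "\<dots> = mat r r (\<lambda>(i, j). A $$ (f i, g j))"
    by (intro eq_matI) (auto simp: pick_image_increasing[OF f] pick_image_increasing[OF g])
  finally show ?thesis .
qed

text \<open>Index sets and increasing maps correspond through \<open>pick\<close> and images, so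
  minors can be handled by \<open>fdet\<close>.\<close>

lemma square_submatrices_eq:
  "square_submatrices r A = {mat r r (\<lambda>(i, j). A $$ (f i, g j)) | f g.
     increasing_below r (dim_row A) f \<and> increasing_below r (dim_col A) g}" (is "?L = ?R")
proof (intro subset_antisym subsetI)
  fix B assume "B \<in> ?L"
  then obtain I J where "B = submatrix A I J" and IJ: "I \<subseteq> {0..<dim_row A}" "J \<subseteq> {0..<dim_col A}"
    "card I = r" "card J = r"
    unfolding square_submatrices_def by blast
  then have "B = mat r r (\<lambda>(i, j). A $$ (pick I i, pick J j))" by (simp add: submatrix_eq_mat)
  with IJ show "B \<in> ?R" using increasing_below_pick by blast
next
  fix B assume "B \<in> ?R"
  then obtain f g where B: "B = mat r r (\<lambda>(i, j). A $$ (f i, g j))"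
    and fg: "increasing_below r (dim_row A) f" "increasing_below r (dim_col A) g" by blast
  then have "B = submatrix A (f ` {..<r}) (g ` {..<r})" by (simp add: submatrix_image_increasing)
  moreover have "f ` {..<r} \<subseteq> {0..<dim_row A}" "g ` {..<r} \<subseteq> {0..<dim_col A}"
    using fg by (auto simp: increasing_below_def)
  ultimately show "B \<in> ?L"
    unfolding square_submatrices_def using fg[THEN card_image_increasing] by blast
qed

lemma contiguous_square_submatrices_subset:
  "contiguous_square_submatrices r A \<subseteq> square_submatrices r A"
  unfolding contiguous_square_submatrices_def square_submatrices_def by blast

lemma shift_in_contiguous_square_submatrices:
  assumes "a + r \<le> dim_row A" "b + r \<le> dim_col A"
  shows "mat r r (\<lambda>(i, j). A $$ (a + i, b + j)) \<in> contiguous_square_submatrices r A"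
proof -
  have img: "(\<lambda>i. c + i) ` {..<r} = {c..<c + r}" for c
    by (simp add: lessThan_atLeast0 image_add_atLeastLessThan add.commute)
  have "mat r r (\<lambda>(i, j). A $$ (a + i, b + j)) = submatrix A {a..<a + r} {b..<b + r}"
    using submatrix_image_increasing[OF assms[THEN increasing_below_shift]] by (simp add: img)
  then show ?thesis
    using assms unfolding contiguous_square_submatrices_def consecutive_def
    by (intro CollectI exI[of _ "{a..<a + r}"] exI[of _ "{b..<b + r}"]) auto
qed

section \<open>Solution sets in coordinates\<close>

text \<open>A sum of nonnegative products vanishes exactly when each product does.\<close>

lemma LCP_SOL_iff:
  assumes M: "M \<in> carrier_mat r r" and q: "q \<in> carrier_vec r"
  shows "x \<in> LCP_SOL M q \<longleftrightarrow>
    x \<in> carrier_vec r \<and> lcp_sol r (\<lambda>i j. M $$ (i, j)) (\<lambda>i. q $ i) (\<lambda>i. x $ i)"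
proof (cases "x \<in> carrier_vec r")
  case x: True
  let ?y = "\<lambda>i. (\<Sum>j<r. M $$ (i, j) * x $ j) + q $ i"
  have y: "(M *\<^sub>v x + q) $ i = ?y i" if "i < r" for i
    using that M q x by (auto simp: scalar_prod_def atLeast0LessThan)
  have dim: "dim_vec (M *\<^sub>v x + q) = r" using q by simp
  have inner: "x \<bullet> (M *\<^sub>v x + q) = (\<Sum>i<r. x $ i * ?y i)"
    unfolding scalar_prod_def dim atLeast0LessThan by (intro sum.cong) (simp_all add: y)
  have "x \<in> LCP_SOL M q \<longleftrightarrow> (\<forall>i<r. 0 \<le> x $ i \<and> 0 \<le> ?y i) \<and> (\<Sum>i<r. x $ i * ?y i) = 0"
    unfolding LCP_SOL_def mem_Collect_eq inner less_eq_vec_def dim using x q M y by auto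
  also have "\<dots> \<longleftrightarrow> (\<forall>i<r. 0 \<le> x $ i \<and> 0 \<le> ?y i \<and> x $ i * ?y i = 0)"
  proof -
    have "(\<Sum>i<r. x $ i * ?y i) = 0 \<longleftrightarrow> (\<forall>i<r. x $ i * ?y i = 0)"
      if "\<forall>i<r. 0 \<le> x $ i \<and> 0 \<le> ?y i"
      using that sum_nonneg_eq_0_iff[of "{..<r}" "\<lambda>i. x $ i * ?y i"] by (simp add: mult_nonneg_nonneg Ball_def)
    then show ?thesis by blast
  qed
  finally show ?thesis using x by (simp add: lcp_sol_def)
next
  case False
  then show ?thesis using q by (auto simp: LCP_SOL_def)
qed

lemma LCP_unique_solution:
  assumes M: "M \<in> carrier_mat r r" and q: "q \<in> carrier_vec r"
    and rev: "reverses_no_signs r (\<lambda>i j. M $$ (i, j))"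
  shows "\<exists>!x. x \<in> LCP_SOL M q"
proof -
  obtain x where "lcp_sol r (\<lambda>i j. M $$ (i, j)) (\<lambda>i. q $ i) x"
    using lcp_sol_exists[OF rev] by blast
  then have "vec r x \<in> LCP_SOL M q"
    unfolding LCP_SOL_iff[OF M q] lcp_sol_def by simp
  moreover have "y = z" if "y \<in> LCP_SOL M q" "z \<in> LCP_SOL M q" for y z
    using that lcp_sol_unique[OF rev] unfolding LCP_SOL_iff[OF M q] by (intro eq_vecI) auto
  ultimately show ?thesis by blast
qed

section \<open>From the sign patterns back to total positivity\<close>

text \<open>Deleting row 0 yields cofactors \<open>C\<close>, whose even and odd parts
  \<open>xp\<close> and \<open>xm\<close> have images under \<open>B\<close> that differ only in
  coordinate 0, by the determinant.\<close>

lemma two_alternating_solutions: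
  fixes B :: "nat \<Rightarrow> nat \<Rightarrow> real" and u :: nat
  defines "M \<equiv> mat (Suc (Suc u)) (Suc (Suc u)) (\<lambda>(i, j). B i j)"
  assumes entries: "\<And>i j. i < Suc (Suc u) \<Longrightarrow> j < Suc (Suc u) \<Longrightarrow> B i j > 0"
    and minors: "\<And>j. j < Suc (Suc u) \<Longrightarrow> fdet (Suc u) (\<lambda>a b. B (Suc a) (insert_index j b)) > 0"
    and det: "fdet (Suc (Suc u)) B \<le> 0"
  shows "\<exists>q \<in> carrier_vec (Suc (Suc u)). vec_negative q \<and>
    (\<exists>x \<in> LCP_SOL M q. sign_pattern_plus_zero x) \<and> (\<exists>x \<in> LCP_SOL M q. sign_pattern_zero_plus x)"
proof -
  let ?r = "Suc (Suc u)"
  define C where "C j = fdet (Suc u) (\<lambda>a b. B (Suc a) (insert_index j b))" for j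
  define xp where "xp j = (if even j then C j else 0)" for j
  define xm where "xm j = (if even j then 0 else C j)" for j
  let ?S = "\<lambda>i x. \<Sum>j<?r. B i j * x j"
  have C: "C j > 0" if "j < ?r" for j using minors[OF that] by (simp add: C_def)
  have diff: "?S i xp - ?S i xm = (if i = 0 then fdet ?r B else 0)" if i: "i < ?r" for i
  proof -
    \<comment> \<open>Overwriting row 0 leaves its cofactors unchanged, and for
      \<open>i \<noteq> 0\<close> creates two equal rows.\<close>
    let ?N = "B(0 := B i)"
    have "?S i xp - ?S i xm = (\<Sum>j<?r. (-1) ^ (0 + j) * ?N 0 j *
        fdet (Suc u) (\<lambda>a b. ?N (insert_index 0 a) (insert_index j b)))"
      unfolding sum_subtractf[symmetric]
      by (intro sum.cong refl) (simp add: xp_def xm_def C_def)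
    also have "\<dots> = fdet ?r ?N" by (rule fdet_expand_row[symmetric]) simp
    also have "\<dots> = (if i = 0 then fdet ?r B else 0)"
      using i fdet_identical_rows[of 0 ?r i ?N] by (auto simp: fun_upd_idem)
    finally show ?thesis .
  qed
  \<comment> \<open>With this \<open>q\<close> the vector \<open>xp\<close> has slack zero
    everywhere; \<open>q\<close> is negative because the entries of \<open>B\<close> and
    \<open>C 0\<close> are positive.\<close>
  define q where "q = vec ?r (\<lambda>i. - ?S i xp)"
  have Sp: "?S i xp > 0" if "i < ?r" for i
    by (rule sum_pos2[of _ 0])
      (use that entries C in \<open>auto simp: xp_def simp del: sum.lessThan_Suc intro!: mult_nonneg_nonneg less_imp_le[OF entries] less_imp_le[OF C]\<close>)
  have M: "M \<in> carrier_mat ?r ?r" by (simp add: M_def)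
  have q: "q \<in> carrier_vec ?r" by (simp add: q_def)
  have sol: "vec ?r x \<in> LCP_SOL M q" if "lcp_sol ?r B (\<lambda>i. - ?S i xp) x" for x
  proof -
    have sum: "(\<Sum>j<?r. M $$ (i, j) * x j) = ?S i x" if "i < ?r" for i
      using that by (intro sum.cong) (simp_all add: M_def)
    show ?thesis
      unfolding LCP_SOL_iff[OF M q] lcp_sol_def
      using that[unfolded lcp_sol_def] by (simp add: sum q_def del: sum.lessThan_Suc)
  qed
  show ?thesis
  proof (rule bexI[of _ q], intro conjI)
    show "vec_negative q"
      unfolding vec_negative_def q_def using Sp by (simp del: sum.lessThan_Suc)
    have "lcp_sol ?r B (\<lambda>i. - ?S i xp) xp"
      unfolding lcp_sol_def using C by (auto simp: xp_def less_imp_le simp del: sum.lessThan_Suc)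
    from sol[OF this] show "\<exists>x \<in> LCP_SOL M q. sign_pattern_plus_zero x"
      by (rule bexI[rotated]) (use C in \<open>auto simp: sign_pattern_plus_zero_def xp_def\<close>)
    have "lcp_sol ?r B (\<lambda>i. - ?S i xp) xm"
      unfolding lcp_sol_def
    proof (intro allI impI conjI)
      fix i assume i: "i < ?r"
      show "0 \<le> xm i" using C[OF i] by (simp add: xm_def)
      \<comment> \<open>The slack of \<open>xm\<close> lives only at index 0, where
        \<open>xm\<close> is zero, so complementarity holds.\<close>
      have eq: "?S i xm + - ?S i xp = (if i = 0 then - fdet ?r B else 0)"
        using diff[OF i] by (auto simp del: sum.lessThan_Suc split: if_splits)
      show "0 \<le> ?S i xm + - ?S i xp" unfolding eq using det by simp
      show "xm i * (?S i xm + - ?S i xp) = 0" unfolding eq by (simp add: xm_def)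
    qed
    from sol[OF this] show "\<exists>x \<in> LCP_SOL M q. sign_pattern_zero_plus x"
      by (rule bexI[rotated]) (use C in \<open>auto simp: sign_pattern_zero_plus_def xm_def\<close>)
  qed (rule q)
qed

lemma fdet_one: "fdet (Suc 0) B = B 0 0"
  unfolding fdet_def by (simp add: det_single)

theorem theorem1:
  fixes m n k :: nat and A :: "real mat"
  assumes "1 \<le> k" and "k \<le> m" and "k \<le> n"
    and "A \<in> carrier_mat m n"
  shows
    "(totally_positive_of_order k A \<longleftrightarrow>
       (\<forall>r\<in>{1..k}. \<forall>B\<in>square_submatrices r A. \<forall>q\<in>carrier_vec r.
          \<exists>!x. x \<in> LCP_SOL B q)) \<and>
     (totally_positive_of_order k A \<longleftrightarrow>
       (\<forall>r\<in>{1..k}. \<forall>B\<in>contiguous_square_submatrices r A. \<forall>q\<in>carrier_vec r.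
          vec_negative q \<longrightarrow> (\<exists>!x. x \<in> LCP_SOL B q))) \<and>
     (totally_positive_of_order k A \<longleftrightarrow>
       (\<forall>r\<in>{2..k}. \<forall>B\<in>contiguous_square_submatrices r A. \<forall>q\<in>carrier_vec r.
          vec_negative q \<longrightarrow>
            \<not> ((\<exists>x\<in>LCP_SOL B q. sign_pattern_plus_zero x) \<and>
               (\<exists>x\<in>LCP_SOL B q. sign_pattern_zero_plus x))) \<and>
       (\<forall>i<m. \<forall>j<n. \<exists>q::real. q < 0 \<and>
          LCP_SOL (mat 1 1 (\<lambda>_. A $$ (i, j))) (vec 1 (\<lambda>_. q)) \<noteq> {}))"
    (is "(?i \<longleftrightarrow> ?ii) \<and> (?i \<longleftrightarrow> ?iii) \<and> (?i \<longleftrightarrow> ?iv \<and> ?entries)")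
proof -
  have dim: "dim_row A = m" "dim_col A = n" using assms(4) by auto
  let ?a = "\<lambda>i j. A $$ (i, j)"
  have i_ii: "?ii" if "?i"
  proof (intro ballI)
    fix r B and q :: "real vec" assume r: "r \<in> {1..k}" and B: "B \<in> square_submatrices r A" and q: "q \<in> carrier_vec r"
    obtain f g where B: "B = mat r r (\<lambda>(i, j). A $$ (f i, g j))"
      and fg: "increasing_below r m f" "increasing_below r n g"
      using B unfolding square_submatrices_eq dim by blast
    \<comment> \<open>A principal minor of \<open>B\<close> is the minor of \<open>A\<close> with
      rows \<open>f \<circ> e\<close> and columns \<open>g \<circ> e\<close>.\<close>
    have "fdet s (\<lambda>i j. B $$ (e i, e j)) > 0" if e: "increasing_below s r e" for s e
    proof (cases "s = 0")
      case True
      then show ?thesis by (simp add: fdet_def)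
    next
      case False
      have "s \<le> r"
        using card_image_increasing[OF e] card_mono[of "{..<r}" "e ` {..<s}"] e
        by (auto simp: increasing_below_def)
      with False r have s: "s \<in> {1..k}" by auto
      have "mat s s (\<lambda>(i, j). A $$ ((f \<circ> e) i, (g \<circ> e) j)) \<in> square_submatrices s A"
        unfolding square_submatrices_eq dim using fg[THEN increasing_below_comp, OF e] by blast
      with \<open>?i\<close> s have "fdet s (\<lambda>i j. A $$ ((f \<circ> e) i, (g \<circ> e) j)) > 0"
        unfolding totally_positive_of_order_def fdet_def by blast
      also have "fdet s (\<lambda>i j. A $$ ((f \<circ> e) i, (g \<circ> e) j)) = fdet s (\<lambda>i j. B $$ (e i, e j))"
        using e by (intro fdet_cong) (auto simp: B increasing_below_def)
      finally show ?thesis .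
    qed
    then have "reverses_no_signs r (\<lambda>i j. B $$ (i, j))" by (rule P_matrix_reverses_no_signs)
    then show "\<exists>!x. x \<in> LCP_SOL B q"
      using q by (intro LCP_unique_solution) (auto simp: B)
  qed
  have ii_iii: "?iii" if "?ii"
    using that contiguous_square_submatrices_subset by blast
  have iii_iv: "?iv \<and> ?entries" if "?iii"
  proof (intro conjI ballI impI allI notI)
    fix r B and q :: "real vec"
    assume r: "r \<in> {2..k}" and B: "B \<in> contiguous_square_submatrices r A"
      and q: "q \<in> carrier_vec r" "vec_negative q"
      and "(\<exists>x\<in>LCP_SOL B q. sign_pattern_plus_zero x) \<and> (\<exists>x\<in>LCP_SOL B q. sign_pattern_zero_plus x)"
    then obtain x y where xy: "x \<in> LCP_SOL B q" "sign_pattern_plus_zero x"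
      "y \<in> LCP_SOL B q" "sign_pattern_zero_plus y" by blast
    have "r \<in> {1..k}" using r by simp
    with \<open>?iii\<close> B q xy(1,3) have "x = y" by blast
    moreover have "dim_vec x = r" using xy(1) q(1) by (auto simp: LCP_SOL_def)
    \<comment> \<open>The two patterns already disagree at index 0.\<close>
    ultimately have "x $ 0 > 0" "x $ 0 = 0"
      using xy(2,4) r unfolding sign_pattern_plus_zero_def sign_pattern_zero_plus_def by force+
    then show False by simp
  next
    fix i j assume ij: "i < m" "j < n"
    let ?q = "vec 1 (\<lambda>_. - 1 :: real)"
    have "mat 1 1 (\<lambda>(a, b). A $$ (i + a, j + b)) \<in> contiguous_square_submatrices 1 A"
      using ij dim by (intro shift_in_contiguous_square_submatrices) auto
    also have "mat 1 1 (\<lambda>(a, b). A $$ (i + a, j + b)) = mat 1 1 (\<lambda>_. A $$ (i, j))"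
      by (intro eq_matI) auto
    finally have "\<exists>!x. x \<in> LCP_SOL (mat 1 1 (\<lambda>_. A $$ (i, j))) ?q"
      using \<open>?iii\<close>[rule_format, of 1 _ ?q] assms(1) by (auto simp: vec_negative_def)
    then show "\<exists>q::real. q < 0 \<and> LCP_SOL (mat 1 1 (\<lambda>_. A $$ (i, j))) (vec 1 (\<lambda>_. q)) \<noteq> {}"
      by (intro exI[of _ "- 1"]) auto
  qed
  have iv_i: "?i" if "?iv \<and> ?entries"
  proof -
    have entry: "A $$ (i, j) > 0" if "i < m" "j < n" for i j
    proof -
      obtain q x where "q < 0" "x \<in> LCP_SOL (mat 1 1 (\<lambda>_. A $$ (i, j))) (vec 1 (\<lambda>_. q))"
        using \<open>?iv \<and> ?entries\<close> \<open>i < m\<close> \<open>j < n\<close> by blast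
      then have "0 \<le> x $ 0" "0 \<le> A $$ (i, j) * x $ 0 + q" "q < 0"
        by (auto simp: LCP_SOL_iff[of _ 1] lcp_sol_def)
      \<comment> \<open>Since \<open>q < 0\<close>, the product of the entry with
        \<open>x $ 0 \<ge> 0\<close> must be positive.\<close>
      then show ?thesis by (smt (verit) mult_nonpos_nonneg)
    qed
    \<comment> \<open>Induction on the order: Fekete's criterion leaves only contiguous minors.
      Order 1 is \<open>entry\<close>; from order 2 on, a nonpositive minor gives two solutions with
      the forbidden patterns.\<close>
    have minor: "fdet r (\<lambda>i j. ?a (f i) (g j)) > 0"
      if "r \<le> k" "increasing_below r m f" "increasing_below r n g" for r f g
      using that
    proof (induction r arbitrary: f g)
      case 0
      then show ?case by (simp add: fdet_def)
    next
      case (Suc r)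
      have IH: "fdet r (\<lambda>i j. ?a (f i) (g j)) > 0"
        if "increasing_below r m f" "increasing_below r n g" for f g
        using Suc.IH[OF _ that] Suc.prems(1) by simp
      show ?case
      proof (rule fekete[OF _ _ Suc.prems(2,3)])
        show "fdet (Suc r - 1) (\<lambda>i j. ?a (f' i) (g' j)) > 0"
          if "increasing_below (Suc r - 1) m f'" "increasing_below (Suc r - 1) n g'" for f' g'
          using IH that by simp
        fix a b assume ab: "a + Suc r \<le> m" "b + Suc r \<le> n"
        let ?B = "\<lambda>i j. ?a (a + i) (b + j)"
        show "fdet (Suc r) ?B > 0"
        proof (cases r)
          case 0
          then show ?thesis using entry ab by (simp add: fdet_one)
        next
          case (Suc u)
          show ?thesis
          proof (rule ccontr)
            assume "\<not> fdet (Suc r) ?B > 0"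
            have "\<exists>q \<in> carrier_vec (Suc (Suc u)). vec_negative q \<and>
                (\<exists>x \<in> LCP_SOL (mat (Suc (Suc u)) (Suc (Suc u)) (\<lambda>(i, j). ?B i j)) q. sign_pattern_plus_zero x) \<and>
                (\<exists>x \<in> LCP_SOL (mat (Suc (Suc u)) (Suc (Suc u)) (\<lambda>(i, j). ?B i j)) q. sign_pattern_zero_plus x)"
            proof (rule two_alternating_solutions)
              show "?B i j > 0" if "i < Suc (Suc u)" "j < Suc (Suc u)" for i j
                using that ab Suc by (intro entry) auto
              show "fdet (Suc (Suc u)) ?B \<le> 0"
                using \<open>\<not> fdet (Suc r) ?B > 0\<close> Suc by simp
              show "fdet (Suc u) (\<lambda>i j. ?B (Suc i) (insert_index l j)) > 0" for l
                using ab Suc IH[of "\<lambda>i. a + Suc i" "\<lambda>j. b + insert_index l j"]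
                by (auto simp: increasing_below_def insert_index_def)
            qed
            moreover have "mat (Suc r) (Suc r) (\<lambda>(i, j). ?B i j) \<in> contiguous_square_submatrices (Suc r) A"
              using ab dim by (intro shift_in_contiguous_square_submatrices) auto
            moreover have "Suc r \<in> {2..k}" using Suc.prems(1) \<open>r = Suc u\<close> by simp
            ultimately show False using \<open>?iv \<and> ?entries\<close> unfolding Suc by blast
          qed
        qed
      qed
    qed
    show ?i
      unfolding totally_positive_of_order_def square_submatrices_eq dim
      using minor by (auto simp: fdet_def)
  qed
  have i_iii: "?iii" if "?i" using ii_iii[OF i_ii[OF that]] .
  have i_iv: "?iv \<and> ?entries" if "?i" using iii_iv[OF i_iii[OF that]] .
  have iii_i: "?i" if "?iii" using iv_i[OF iii_iv[OF that]] .
  have ii_i: "?i" if "?ii" using iii_i[OF ii_iii[OF that]] .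
  have "?i \<longleftrightarrow> ?ii" by (rule iffI; erule i_ii ii_i)
  moreover have "?i \<longleftrightarrow> ?iii" by (rule iffI; erule i_iii iii_i)
  moreover have "?i \<longleftrightarrow> ?iv \<and> ?entries" by (rule iffI; erule i_iv iv_i)
  ultimately show ?thesis by (intro conjI)
qed

end
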